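(* Let $s,m,\ell$ be integers with $s\ge 2$, $m\ge 0$ and $\ell\in\{1,\ldots,s\}$. Put $q=sm+s-\ell$ and let $n\ge q$. If $\mathcal F_1,\ldots,\mathcal F_s\subset 2^{[n]}$ are $q$-dependent, then $$\sum_{i=1}^s|\mathcal F_i|\le (\ell-1)\binom{n}{m}+s\sum_{t=m+1}^{n}\binom{n}{t}.$$
   Context: $[n]=\{1,\ldots,n\}$. Families $\mathcal F_1,\ldots,\mathcal F_s\subset 2^{[n]}$ are called $q$-dependent if there are no pairwise disjoint $F_1\in\mathcal F_1,\ldots,F_s\in\mathcal F_s$ with $|F_1\cup\cdots\cup F_s|\le q$. *)

theory Defs
  imports Complex_Main "HOL-Library.Disjoint_Sets"
begin

text \<open>
  The families are indexed by \<open>{1..s}\<close>. Pairwise disjointness is that of the indexed family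
  \<open>G\<close>, so the empty set may be chosen from several of the families at once.
  The notion is meant for families of finite sets, since \<open>card\<close> of an infinite set is \<open>0\<close>.
\<close>

definition q_dependent :: "nat \<Rightarrow> nat \<Rightarrow> (nat \<Rightarrow> 'a set set) \<Rightarrow> bool" where
  "q_dependent q s F \<longleftrightarrow>
     \<not> (\<exists>G. (\<forall>i\<in>{1..s}. G i \<in> F i) \<and> disjoint_family_on G {1..s} \<and>
          card (\<Union>i\<in>{1..s}. G i) \<le> q)"

end

theory Submission
  imports Defs
begin

text \<open>
  Let \<open>f\<^sub>i t\<close> be the proportion of \<open>t\<close>-sets missing from \<open>F\<^sub>i\<close>. Averaging over \<open>x\<close> the density of the
  sets missing from \<open>F\<^sub>i\<close> on the ground set without \<open>x\<close> gives back \<open>f\<^sub>i t\<close>, and averaging that of the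
  link of \<open>x\<close> shifts it to \<open>f\<^sub>i (t + 1)\<close>. When \<open>n = q\<close>, pick \<open>j\<close> with \<open>{} \<notin> F\<^sub>j\<close>, take the link in \<open>F\<^sub>j\<close>
  and delete \<open>x\<close> from the other families: the result is \<open>(q - 1)\<close>-dependent, and the lost term
  \<open>f\<^sub>j 0 = 1\<close> makes the induction give \<open>\<Sum>\<^sub>i \<Sum>\<^sub>t f\<^sub>i t \<ge> q + 1\<close>. The same induction gives
  \<open>\<Sum>\<^sub>i f\<^sub>i a\<^sub>i \<ge> 1\<close> whenever \<open>\<Sum>\<^sub>i a\<^sub>i = q\<close>. Each family may be replaced by its up-closure together with
  all sets of more than \<open>q\<close> elements, so \<open>\<Phi> t = \<Sum>\<^sub>i f\<^sub>i t\<close> is decreasing and vanishes above \<open>q\<close>. It remains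
  to minimise \<open>\<Sum>\<^sub>t (n choose t) \<Phi> t\<close> under these constraints.
\<close>

section \<open>Missing sets, their densities, links and dependence\<close>

definition missing :: "'a set \<Rightarrow> 'a set set \<Rightarrow> nat \<Rightarrow> 'a set set" where
  "missing V F t = {X. X \<subseteq> V \<and> card X = t \<and> X \<notin> F}"

definition miss_density :: "'a set \<Rightarrow> 'a set set \<Rightarrow> nat \<Rightarrow> real" where
  "miss_density V F t = card (missing V F t) / (card V choose t)"

text \<open>The condition \<open>x \<notin> X\<close> is left to the ground set: a link is only ever
  looked at on \<open>V - {x}\<close>.\<close>

definition link :: "'a \<Rightarrow> 'a set set \<Rightarrow> 'a set set" where
  "link x F = {X. insert x X \<in> F}"

text \<open>Choices are confined to \<open>V\<close>, so a point is deleted by shrinking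
  \<open>V\<close> while \<open>F\<close> stays as it is.\<close>

definition cross_dependent :: "nat \<Rightarrow> 'i set \<Rightarrow> 'a set \<Rightarrow> ('i \<Rightarrow> 'a set set) \<Rightarrow> bool" where
  "cross_dependent q I V F \<longleftrightarrow>
     \<not> (\<exists>G. (\<forall>i\<in>I. G i \<in> F i \<and> G i \<subseteq> V) \<and> disjoint_family_on G I \<and>
          card (\<Union>i\<in>I. G i) \<le> q)"

lemma finite_missing: "finite V \<Longrightarrow> finite (missing V F t)"
  unfolding missing_def by (rule finite_subset[of _ "Pow V"]) auto

lemma card_missing_le:
  assumes "finite V" shows "card (missing V F t) \<le> card V choose t"
proof -
  have "card (missing V F t) \<le> card {X. X \<subseteq> V \<and> card X = t}"
    using assms unfolding missing_def by (intro card_mono) auto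
  then show ?thesis using n_subsets[OF assms] by simp
qed

lemma miss_density_nonneg: "0 \<le> miss_density V F t"
  by (simp add: miss_density_def)

lemma miss_density_le_1: "finite V \<Longrightarrow> miss_density V F t \<le> 1"
  using card_missing_le[of V F t] by (auto simp: miss_density_def divide_simps)

lemma miss_density_mult:
  assumes "finite V"
  shows "(card V choose t) * miss_density V F t = card (missing V F t)"
  using card_missing_le[OF assms, of F t] by (cases "card V choose t = 0") (auto simp: miss_density_def)

lemma miss_density_0: "miss_density V F 0 = (if {} \<in> F then 0 else 1)" if "finite V"
proof -
  have "X \<subseteq> V \<and> card X = 0 \<longleftrightarrow> X = {}" for X
    using finite_subset[OF _ that] by auto
  then have "missing V F 0 = (if {} \<in> F then {} else {{}})"
    unfolding missing_def conj_assoc[symmetric] by auto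
  then show ?thesis by (simp add: miss_density_def)
qed

lemma miss_density_top: "miss_density V F (card V) = (if V \<in> F then 0 else 1)" if "finite V"
proof -
  have "X \<subseteq> V \<and> card X = card V \<longleftrightarrow> X = V" for X
    using card_subset_eq[OF that] by auto
  then have "missing V F (card V) = (if V \<in> F then {} else {V})"
    unfolding missing_def conj_assoc[symmetric] by auto
  then show ?thesis by (simp add: miss_density_def)
qed

lemma miss_density_mono:
  assumes "finite V" "\<And>X. X \<subseteq> V \<Longrightarrow> card X = t \<Longrightarrow> X \<in> F \<Longrightarrow> X \<in> F'"
  shows "miss_density V F' t \<le> miss_density V F t"
proof -
  have "card (missing V F' t) \<le> card (missing V F t)"
    using assms finite_missing[OF assms(1)] by (intro card_mono) (auto simp: missing_def)
  then show ?thesis by (simp add: miss_density_def divide_right_mono)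
qed

section \<open>Double counting over deleted points\<close>

text \<open>Pairs of a point \<open>x\<close> and a missing \<open>t\<close>-set avoiding it are
  counted in two ways: each such set avoids exactly \<open>card V - t\<close> points.\<close>

lemma sum_card_missing_delete:
  assumes "finite V"
  shows "(\<Sum>x\<in>V. card (missing (V - {x}) F t)) = (card V - t) * card (missing V F t)"
proof -
  have "(\<Sum>x\<in>V. card (missing (V - {x}) F t)) = (\<Sum>x\<in>V. \<Sum>X\<in>missing V F t. if x \<notin> X then 1 else 0)"
  proof (rule sum.cong[OF refl])
    fix x assume "x \<in> V"
    have "missing (V - {x}) F t = {X \<in> missing V F t. x \<notin> X}"
      by (auto simp: missing_def)
    then show "card (missing (V - {x}) F t) = (\<Sum>X\<in>missing V F t. if x \<notin> X then 1 else 0)"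
      using finite_missing[OF assms] by (simp add: sum.If_cases Int_def)
  qed
  also have "\<dots> = (\<Sum>X\<in>missing V F t. \<Sum>x\<in>V. if x \<notin> X then 1 else 0)"
    by (rule sum.swap)
  also have "\<dots> = (\<Sum>X\<in>missing V F t. card V - t)"
  proof (rule sum.cong[OF refl])
    fix X assume X: "X \<in> missing V F t"
    have "(\<Sum>x\<in>V. if x \<notin> X then 1 else (0::nat)) = card (V - X)"
      using assms by (simp add: sum.If_cases Diff_eq Compl_eq Int_def)
    also have "\<dots> = card V - t"
      using X assms by (auto simp: missing_def card_Diff_subset finite_subset)
    finally show "(\<Sum>x\<in>V. if x \<notin> X then 1 else (0::nat)) = card V - t" .
  qed
  finally show ?thesis by simp
qed

text \<open>The same count for incident pairs; inserting \<open>x\<close> matches the sets missing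
  from the link with the missing \<open>(t + 1)\<close>-sets through \<open>x\<close>.\<close>

lemma sum_card_missing_link:
  assumes "finite V"
  shows "(\<Sum>x\<in>V. card (missing (V - {x}) (link x F) t)) = Suc t * card (missing V F (Suc t))"
proof -
  have "(\<Sum>x\<in>V. card (missing (V - {x}) (link x F) t)) =
        (\<Sum>x\<in>V. \<Sum>X\<in>missing V F (Suc t). if x \<in> X then 1 else 0)"
  proof (rule sum.cong[OF refl])
    fix x assume x: "x \<in> V"
    have "bij_betw (insert x) (missing (V - {x}) (link x F) t) {X \<in> missing V F (Suc t). x \<in> X}"
    proof (rule bij_betw_byWitness[where f' = "\<lambda>X. X - {x}"])
      show "insert x ` missing (V - {x}) (link x F) t \<subseteq> {X \<in> missing V F (Suc t). x \<in> X}"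
      proof
        fix Y assume "Y \<in> insert x ` missing (V - {x}) (link x F) t"
        then obtain X where X: "Y = insert x X" "X \<subseteq> V - {x}" "card X = t" "insert x X \<notin> F"
          by (auto simp: missing_def link_def)
        then have "x \<notin> X" "finite X" using assms by (auto intro: finite_subset)
        then show "Y \<in> {X \<in> missing V F (Suc t). x \<in> X}"
          using X x by (auto simp: missing_def)
      qed
      show "(\<lambda>X. X - {x}) ` {X \<in> missing V F (Suc t). x \<in> X} \<subseteq> missing (V - {x}) (link x F) t"
        by (auto simp: missing_def link_def insert_absorb)
    qed (auto simp: missing_def)
    then have "card (missing (V - {x}) (link x F) t) = card {X \<in> missing V F (Suc t). x \<in> X}"
      by (rule bij_betw_same_card)
    then show "card (missing (V - {x}) (link x F) t) =
        (\<Sum>X\<in>missing V F (Suc t). if x \<in> X then 1 else 0)"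
      using finite_missing[OF assms] by (simp add: sum.If_cases Int_def)
  qed
  also have "\<dots> = (\<Sum>X\<in>missing V F (Suc t). \<Sum>x\<in>V. if x \<in> X then 1 else 0)"
    by (rule sum.swap)
  also have "\<dots> = (\<Sum>X\<in>missing V F (Suc t). Suc t)"
  proof (rule sum.cong[OF refl])
    fix X assume X: "X \<in> missing V F (Suc t)"
    then have "V \<inter> {x. x \<in> X} = X" "card X = Suc t" by (auto simp: missing_def)
    then show "(\<Sum>x\<in>V. if x \<in> X then 1 else (0::nat)) = Suc t"
      using assms by (simp add: sum.If_cases)
  qed
  finally show ?thesis by simp
qed

text \<open>For \<open>card V = n + 1\<close> the count turns into an unweighted average by
  \<open>(n + 1 - t) * (n + 1 choose t) = (n + 1) * (n choose t)\<close>. At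
  \<open>t = card V\<close> the left side would be 0, hence the strict bound.\<close>

lemma sum_miss_density_delete:
  assumes "finite V" "t < card V"
  shows "(\<Sum>x\<in>V. miss_density (V - {x}) F t) = card V * miss_density V F t"
proof -
  obtain n where n: "card V = Suc n" using assms(2) by (cases "card V") auto
  have c: "(Suc n - t) * (Suc n choose t) = Suc n * (n choose t)"
    using binomial_absorb_comp[of "Suc n" t] by simp
  have pos: "n choose t > 0" "Suc n choose t > 0" using assms(2) n by (auto simp: zero_less_binomial_iff)
  have "(\<Sum>x\<in>V. miss_density (V - {x}) F t) = (\<Sum>x\<in>V. card (missing (V - {x}) F t)) / (n choose t)"
    using assms n by (simp add: miss_density_def sum_divide_distrib)
  also have "\<dots> = real (Suc n - t) * card (missing V F t) / (n choose t)"
    using sum_card_missing_delete[OF assms(1), of F t] n by (metis of_nat_mult of_nat_sum)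
  also have "\<dots> = Suc n * miss_density V F t"
  proof -
    have "real (Suc n - t) * real (Suc n choose t) = real (Suc n) * real (n choose t)"
      using c by (metis of_nat_mult)
    then have "real (Suc n - t) / (n choose t) = real (Suc n) / (Suc n choose t)"
      using pos by (simp add: frac_eq_eq)
    then show ?thesis unfolding miss_density_def n
      by (metis (no_types, opaque_lifting) times_divide_eq_left times_divide_eq_right mult.commute)
  qed
  finally show ?thesis using n by simp
qed

lemma sum_miss_density_link:
  assumes "finite V" "t < card V"
  shows "(\<Sum>x\<in>V. miss_density (V - {x}) (link x F) t) = card V * miss_density V F (Suc t)"
proof -
  obtain n where n: "card V = Suc n" using assms(2) by (cases "card V") auto
  have c: "Suc t * (Suc n choose Suc t) = Suc n * (n choose t)"
    by (rule Suc_times_binomial)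
  have pos: "n choose t > 0" "Suc n choose Suc t > 0" using assms(2) n
    by (auto simp: zero_less_binomial_iff)
  have "(\<Sum>x\<in>V. miss_density (V - {x}) (link x F) t) =
      (\<Sum>x\<in>V. card (missing (V - {x}) (link x F) t)) / (n choose t)"
    using assms n by (simp add: miss_density_def sum_divide_distrib)
  also have "\<dots> = real (Suc t) * card (missing V F (Suc t)) / (n choose t)"
    using sum_card_missing_link[OF assms(1), of F t] n by (metis of_nat_mult of_nat_sum)
  also have "\<dots> = Suc n * miss_density V F (Suc t)"
  proof -
    have "real (Suc t) * real (Suc n choose Suc t) = real (Suc n) * real (n choose t)"
      using c by (metis of_nat_mult)
    then have "real (Suc t) / (n choose t) = real (Suc n) / (Suc n choose Suc t)"
      using pos by (simp add: frac_eq_eq del: binomial_Suc_Suc)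
    then show ?thesis unfolding miss_density_def n
      by (metis (no_types, opaque_lifting) times_divide_eq_left times_divide_eq_right mult.commute)
  qed
  finally show ?thesis using n by simp
qed

text \<open>On \<open>V - {x}\<close> an up-closed family is contained in its own link, so the link
  misses no more sets; averaging over \<open>x\<close> compares the layers \<open>t + 1\<close> and
  \<open>t\<close>.\<close>

lemma miss_density_Suc_le:
  assumes "finite V" "t < card V"
    and up: "\<And>X x. X \<in> F \<Longrightarrow> X \<subseteq> V \<Longrightarrow> x \<in> V \<Longrightarrow> insert x X \<in> F"
  shows "miss_density V F (Suc t) \<le> miss_density V F t"
proof -
  have "(\<Sum>x\<in>V. miss_density (V - {x}) (link x F) t) \<le> (\<Sum>x\<in>V. miss_density (V - {x}) F t)"
    using assms(1) by (intro sum_mono miss_density_mono) (auto simp: link_def intro!: up)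
  then have "card V * miss_density V F (Suc t) \<le> card V * miss_density V F t"
    using sum_miss_density_link[OF assms(1,2), of F] sum_miss_density_delete[OF assms(1,2), of F] by simp
  then show ?thesis using assms(2) by simp
qed

section \<open>Density inequalities for dependent families\<close>

lemma cross_dependent_delete:
  "cross_dependent q I V F \<Longrightarrow> cross_dependent q I (V - {x}) F"
  unfolding cross_dependent_def by blast

text \<open>All chosen sets avoid \<open>x\<close>, so putting \<open>x\<close> back into
  \<open>G j\<close> keeps them disjoint and enlarges the union by just one element.\<close>

lemma cross_dependent_link:
  assumes dep: "cross_dependent (Suc q) I V F" and "j \<in> I" "x \<in> V" "finite V"
  shows "cross_dependent q I (V - {x}) (F(j := link x (F j)))"
  unfolding cross_dependent_def
proof (rule notI, elim exE conjE)
  fix G assume G: "\<forall>i\<in>I. G i \<in> (F(j := link x (F j))) i \<and> G i \<subseteq> V - {x}"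
    and disj: "disjoint_family_on G I" and le: "card (\<Union>i\<in>I. G i) \<le> q"
  let ?G = "G(j := insert x (G j))"
  have 1: "\<forall>i\<in>I. ?G i \<in> F i \<and> ?G i \<subseteq> V"
    using G assms(2,3) by (auto simp: link_def split: if_splits)
  have 2: "disjoint_family_on ?G I"
    using disj G assms(2) unfolding disjoint_family_on_def by (auto split: if_splits)
  have fin: "finite (\<Union>i\<in>I. G i)"
    using G assms(4) by (intro finite_subset[OF _ assms(4)]) auto
  have "(\<Union>i\<in>I. ?G i) = insert x (\<Union>i\<in>I. G i)"
    using assms(2) by auto
  then have 3: "card (\<Union>i\<in>I. ?G i) \<le> Suc q"
    using le fin by (simp add: card_insert_if)
  show False using dep 1 2 3 unfolding cross_dependent_def by blast
qed

lemma cross_dependent_empty_notin: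
  assumes "cross_dependent q I V F" obtains j where "j \<in> I" "{} \<notin> F j"
proof -
  have "\<not> (\<forall>i\<in>I. {} \<in> F i)"
    using assms unfolding cross_dependent_def
    by (auto simp: disjoint_family_on_def dest!: spec[of _ "\<lambda>_. {}"])
  then show thesis using that by blast
qed

lemma sum_fun_upd_split:
  fixes g :: "'i \<Rightarrow> 'a set set \<Rightarrow> real"
  assumes "finite I" "j \<in> I"
  shows "(\<Sum>i\<in>I. g i ((F(j := A)) i)) = g j A + (\<Sum>i\<in>I - {j}. g i (F i))"
  using assms by (simp add: sum.remove)

lemma sum_miss_density_ge:
  assumes "finite V" "finite I" "q \<le> card V" "cross_dependent q I V F"
  shows "real q + 1 \<le> (\<Sum>i\<in>I. \<Sum>t\<le>card V. miss_density V (F i) t)"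
  using assms
proof (induction "card V" arbitrary: V q F)
  case 0
  obtain j where j: "j \<in> I" "{} \<notin> F j" using cross_dependent_empty_notin[OF 0(5)] .
  have "real q + 1 = miss_density V (F j) 0"
    using 0 j by (simp add: miss_density_0)
  also have "\<dots> \<le> (\<Sum>i\<in>I. miss_density V (F i) 0)"
    using 0 j by (intro member_le_sum) (auto simp: miss_density_nonneg)
  finally show ?case using 0 by simp
next
  case (Suc n)
  let ?f = "miss_density V"
  have V: "card V = Suc n" "V \<noteq> {}" using Suc(2) by auto
  have cV: "card (V - {x}) = n" if "x \<in> V" for x using V that Suc(3) by simp
  have del: "(\<Sum>x\<in>V. \<Sum>t\<le>n. miss_density (V - {x}) A t) = Suc n * (\<Sum>t\<le>n. ?f A t)" for A
  proof -
    have "(\<Sum>x\<in>V. \<Sum>t\<le>n. miss_density (V - {x}) A t) = (\<Sum>t\<le>n. \<Sum>x\<in>V. miss_density (V - {x}) A t)"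
      by (rule sum.swap)
    also have "\<dots> = (\<Sum>t\<le>n. Suc n * ?f A t)"
      using Suc(3) V by (intro sum.cong[OF refl]) (subst sum_miss_density_delete, auto)
    finally show ?thesis by (simp add: sum_distrib_left)
  qed
  have lnk: "(\<Sum>x\<in>V. \<Sum>t\<le>n. miss_density (V - {x}) (link x A) t) = Suc n * (\<Sum>t\<le>n. ?f A (Suc t))" for A
  proof -
    have "(\<Sum>x\<in>V. \<Sum>t\<le>n. miss_density (V - {x}) (link x A) t) =
        (\<Sum>t\<le>n. \<Sum>x\<in>V. miss_density (V - {x}) (link x A) t)"
      by (rule sum.swap)
    also have "\<dots> = (\<Sum>t\<le>n. Suc n * ?f A (Suc t))"
      using Suc(3) V by (intro sum.cong[OF refl]) (subst sum_miss_density_link, auto)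
    finally show ?thesis by (simp add: sum_distrib_left)
  qed
  have tot1: "(\<Sum>t\<le>n. ?f A t) \<le> (\<Sum>t\<le>Suc n. ?f A t)" for A
    by (simp add: miss_density_nonneg)
  show ?case
  proof (cases "q \<le> n")
    case True
    have "(\<Sum>x\<in>V. real q + 1) \<le> (\<Sum>x\<in>V. \<Sum>i\<in>I. \<Sum>t\<le>n. miss_density (V - {x}) (F i) t)"
    proof (rule sum_mono)
      fix x assume x: "x \<in> V"
      show "real q + 1 \<le> (\<Sum>i\<in>I. \<Sum>t\<le>n. miss_density (V - {x}) (F i) t)"
        using Suc(1)[of "V - {x}" q F] cV[OF x] Suc(3,4) True cross_dependent_delete[OF Suc(6)] by simp
    qed
    also have "\<dots> = (\<Sum>i\<in>I. \<Sum>x\<in>V. \<Sum>t\<le>n. miss_density (V - {x}) (F i) t)"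
      by (rule sum.swap)
    also have "\<dots> = Suc n * (\<Sum>i\<in>I. \<Sum>t\<le>n. ?f (F i) t)"
      by (simp only: del sum_distrib_left)
    finally have "Suc n * (real q + 1) \<le> Suc n * (\<Sum>i\<in>I. \<Sum>t\<le>n. ?f (F i) t)"
      using V by simp
    then have "real q + 1 \<le> (\<Sum>i\<in>I. \<Sum>t\<le>n. ?f (F i) t)"
      by (rule mult_left_le_imp_le) simp
    also have "\<dots> \<le> (\<Sum>i\<in>I. \<Sum>t\<le>Suc n. ?f (F i) t)"
      by (intro sum_mono tot1)
    finally show ?thesis using V by simp
  next
    case False
    \<comment> \<open>Now \<open>q\<close> exceeds the size of \<open>V - {x}\<close>, so
      \<open>q\<close> has to drop along with the ground set; the link in one family achieves
      this.\<close>
    then have q: "q = Suc n" using Suc(5) V by simp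
    obtain j where j: "j \<in> I" "{} \<notin> F j" using cross_dependent_empty_notin[OF Suc(6)] .
    have "(\<Sum>x\<in>V. real n + 1) \<le>
        (\<Sum>x\<in>V. \<Sum>i\<in>I. \<Sum>t\<le>n. miss_density (V - {x}) ((F(j := link x (F j))) i) t)"
    proof (rule sum_mono)
      fix x assume x: "x \<in> V"
      have "cross_dependent n I (V - {x}) (F(j := link x (F j)))"
        using cross_dependent_link[of n I V F j x] Suc(3,6) q j x by simp
      then show "real n + 1 \<le>
          (\<Sum>i\<in>I. \<Sum>t\<le>n. miss_density (V - {x}) ((F(j := link x (F j))) i) t)"
        using Suc(1)[of "V - {x}" n "F(j := link x (F j))"] cV[OF x] Suc(3,4) by simp
    qed
    also have "\<dots> = (\<Sum>x\<in>V. (\<Sum>t\<le>n. miss_density (V - {x}) (link x (F j)) t) +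
        (\<Sum>i\<in>I - {j}. \<Sum>t\<le>n. miss_density (V - {x}) (F i) t))"
      by (intro sum.cong[OF refl]
          sum_fun_upd_split[where g = "\<lambda>i A. \<Sum>t\<le>n. miss_density (V - {x}) A t" for x])
         (use Suc(4) j in auto)
    also have "\<dots> = Suc n * ((\<Sum>t\<le>n. ?f (F j) (Suc t)) + (\<Sum>i\<in>I - {j}. \<Sum>t\<le>n. ?f (F i) t))"
      by (subst sum.distrib, subst (2) sum.swap, simp only: del lnk sum_distrib_left distrib_left)
    finally have "Suc n * (real n + 1) \<le>
        Suc n * ((\<Sum>t\<le>n. ?f (F j) (Suc t)) + (\<Sum>i\<in>I - {j}. \<Sum>t\<le>n. ?f (F i) t))"
      using V by simp
    then have "real n + 1 \<le> (\<Sum>t\<le>n. ?f (F j) (Suc t)) + (\<Sum>i\<in>I - {j}. \<Sum>t\<le>n. ?f (F i) t)"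
      by (rule mult_left_le_imp_le) simp
    \<comment> \<open>The link accounts for layers 1 to \<open>n + 1\<close> of \<open>F j\<close>;
      layer 0 has density 1 because \<open>{} \<notin> F j\<close>, which lifts the bound
      \<open>n + 1\<close> to \<open>q + 1\<close>.\<close>
    moreover have "(\<Sum>t\<le>Suc n. ?f (F j) t) = 1 + (\<Sum>t\<le>n. ?f (F j) (Suc t))"
      using j Suc(3) by (subst sum.atMost_Suc_shift) (simp add: miss_density_0)
    moreover have "(\<Sum>i\<in>I - {j}. \<Sum>t\<le>n. ?f (F i) t) \<le> (\<Sum>i\<in>I - {j}. \<Sum>t\<le>Suc n. ?f (F i) t)"
      by (intro sum_mono tot1)
    moreover have "(\<Sum>i\<in>I. \<Sum>t\<le>Suc n. ?f (F i) t) =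
        (\<Sum>t\<le>Suc n. ?f (F j) t) + (\<Sum>i\<in>I - {j}. \<Sum>t\<le>Suc n. ?f (F i) t)"
      using Suc(4) j(1) by (rule sum.remove)
    ultimately show ?thesis using q V by simp
  qed
qed

text \<open>A union bound: among random disjoint sets of sizes \<open>a i\<close>, dependence forces
  at least one to be missing from its family, and \<open>miss_density V (F i) (a i)\<close> is the
  probability that the \<open>i\<close>-th one is. The induction forms this average one point at a
  time.\<close>

lemma sum_miss_density_sizes_ge_1:
  assumes "finite V" "finite I" "sum a I \<le> card V" "cross_dependent (sum a I) I V F"
  shows "1 \<le> (\<Sum>i\<in>I. miss_density V (F i) (a i))"
  using assms
proof (induction "card V" arbitrary: V a F)
  case 0
  obtain j where j: "j \<in> I" "{} \<notin> F j" using cross_dependent_empty_notin[OF 0(5)] .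
  have a: "a i = 0" if "i \<in> I" for i using 0 that by simp
  have "1 = miss_density V (F j) (a j)"
    using 0 j a by (simp add: miss_density_0)
  also have "\<dots> \<le> (\<Sum>i\<in>I. miss_density V (F i) (a i))"
    using 0 j by (intro member_le_sum) (auto simp: miss_density_nonneg)
  finally show ?case .
next
  case (Suc n)
  let ?f = "miss_density V"
  have V: "card V = Suc n" using Suc(2) by simp
  have cV: "card (V - {x}) = n" if "x \<in> V" for x using V that Suc(3) by simp
  show ?case
  proof (cases "sum a I \<le> n")
    case True
    have ai: "a i < card V" if "i \<in> I" for i
      using True V member_le_sum[of i I a] that Suc(4) by simp
    have "(\<Sum>x\<in>V. 1) \<le> (\<Sum>x\<in>V. \<Sum>i\<in>I. miss_density (V - {x}) (F i) (a i))"
    proof (rule sum_mono)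
      fix x assume x: "x \<in> V"
      show "1 \<le> (\<Sum>i\<in>I. miss_density (V - {x}) (F i) (a i))"
        using Suc(1)[of "V - {x}" a F] cV[OF x] Suc(3,4) True cross_dependent_delete[OF Suc(6)] by simp
    qed
    also have "\<dots> = (\<Sum>i\<in>I. \<Sum>x\<in>V. miss_density (V - {x}) (F i) (a i))"
      by (rule sum.swap)
    also have "\<dots> = (\<Sum>i\<in>I. Suc n * ?f (F i) (a i))"
      using V Suc(3) ai by (intro sum.cong[OF refl]) (simp add: sum_miss_density_delete)
    finally have "real (Suc n) * 1 \<le> Suc n * (\<Sum>i\<in>I. ?f (F i) (a i))"
      using V by (simp add: sum_distrib_left)
    then show ?thesis by (rule mult_left_le_imp_le) simp
  next
    case False
    then have q: "sum a I = Suc n" using Suc(5) V by simp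
    \<comment> \<open>A link in a family with \<open>a j > 0\<close> lowers \<open>a j\<close>, the
      total and \<open>q\<close> together by one.\<close>
    then obtain j where j: "j \<in> I" "a j \<noteq> 0" by (metis sum.neutral nat.distinct(1))
    then obtain b where b: "a j = Suc b" by (cases "a j") auto
    have sj: "sum a I = a j + sum a (I - {j})" using Suc(4) j by (simp add: sum.remove)
    have ai: "a i < card V" if "i \<in> I - {j}" for i
      using sj b q V member_le_sum[of i "I - {j}" a] that Suc(4) by simp
    have bn: "b < card V" using sj b q V by simp
    have sb: "sum (a(j := b)) I = n"
    proof -
      have "sum (a(j := b)) I = b + sum a (I - {j})" using Suc(4) j by (simp add: sum.remove)
      then show ?thesis using sj b q by simp
    qed
    have "(\<Sum>x\<in>V. 1) \<le>
        (\<Sum>x\<in>V. miss_density (V - {x}) (link x (F j)) b +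
          (\<Sum>i\<in>I - {j}. miss_density (V - {x}) (F i) (a i)))"
    proof (rule sum_mono)
      fix x assume x: "x \<in> V"
      have "cross_dependent n I (V - {x}) (F(j := link x (F j)))"
        using cross_dependent_link[of n I V F j x] Suc(3,6) q j x by simp
      then have "1 \<le> (\<Sum>i\<in>I. miss_density (V - {x}) ((F(j := link x (F j))) i) ((a(j := b)) i))"
        using Suc(1)[of "V - {x}" "a(j := b)" "F(j := link x (F j))"] cV[OF x] Suc(3,4) sb by simp
      also have "\<dots> = miss_density (V - {x}) (link x (F j)) b +
          (\<Sum>i\<in>I - {j}. miss_density (V - {x}) (F i) (a i))"
        using Suc(4) j by (simp add: sum.remove)
      finally show "1 \<le> miss_density (V - {x}) (link x (F j)) b +
          (\<Sum>i\<in>I - {j}. miss_density (V - {x}) (F i) (a i))" .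
    qed
    also have "\<dots> = (\<Sum>x\<in>V. miss_density (V - {x}) (link x (F j)) b) +
        (\<Sum>i\<in>I - {j}. \<Sum>x\<in>V. miss_density (V - {x}) (F i) (a i))"
      by (subst sum.distrib, subst (2) sum.swap, rule refl)
    also have "\<dots> = Suc n * ?f (F j) (a j) + (\<Sum>i\<in>I - {j}. Suc n * ?f (F i) (a i))"
      using Suc(3) V bn b ai by (simp add: sum_miss_density_link sum_miss_density_delete)
    also have "\<dots> = Suc n * (\<Sum>i\<in>I. ?f (F i) (a i))"
      using Suc(4) j by (simp add: sum.remove sum_distrib_left distrib_left)
    finally have "real (Suc n) * 1 \<le> Suc n * (\<Sum>i\<in>I. ?f (F i) (a i))"
      using V by simp
    then show ?thesis by (rule mult_left_le_imp_le) simp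
  qed
qed

section \<open>From cardinalities to a linear minimisation over layer profiles\<close>

lemma card_family_eq:
  assumes "finite V" "F \<subseteq> Pow V"
  shows "real (card F) = (\<Sum>t\<le>card V. (card V choose t) * (1 - miss_density V F t))"
proof -
  have eq: "Pow V - F = (\<Union>t\<in>{..card V}. missing V F t)"
    using assms(1) by (auto simp: missing_def intro: card_mono)
  have "card (Pow V - F) = (\<Sum>t\<le>card V. card (missing V F t))"
    unfolding eq using finite_missing[OF assms(1)]
    by (intro card_UN_disjoint) (auto simp: missing_def)
  moreover have "card (Pow V - F) = 2 ^ card V - card F" "card F \<le> 2 ^ card V"
    using assms card_mono[of "Pow V" F] by (auto simp: card_Diff_subset finite_subset card_Pow)
  ultimately have "card F + (\<Sum>t\<le>card V. card (missing V F t)) = (\<Sum>t\<le>card V. card V choose t)"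
    by (simp add: choose_row_sum)
  then have "real (card F) + (\<Sum>t\<le>card V. real (card (missing V F t))) =
      (\<Sum>t\<le>card V. real (card V choose t))"
    by (metis of_nat_add of_nat_sum)
  then show ?thesis
    using assms(1) by (simp add: right_diff_distrib sum_subtractf miss_density_mult)
qed

text \<open>Unimodality and symmetry: the hypotheses put \<open>t\<close> between \<open>k\<close>
  and \<open>n - k\<close>, and beyond the middle \<open>n - t \<ge> k\<close> takes the place of
  \<open>t\<close>.\<close>

lemma binomial_le_middle:
  assumes "k \<le> t" "t + k \<le> n"
  shows "n choose k \<le> n choose t"
proof (cases "2 * t \<le> n")
  case True
  then show ?thesis using assms binomial_mono by blast
next
  case False
  have "n choose k \<le> n choose (n - t)" using assms False by (intro binomial_mono) auto
  then show ?thesis using assms binomial_symmetric[of t n] by simp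
qed

lemma binomial_step:
  assumes "1 \<le> k" "k \<le> n"
  shows "real k * (n choose k) = real (n - k + 1) * (n choose (k - 1))"
proof -
  obtain j where j: "k = Suc j" using assms by (cases k) auto
  have "Suc j * (n choose Suc j) = (n - j) * (n choose j)"
    using binomial_absorption[of j n] binomial_absorb_comp[of n j] by simp
  then have "real (Suc j) * (n choose Suc j) = real (n - j) * (n choose j)"
    by (metis of_nat_mult)
  then show ?thesis using j assms by (simp add: Suc_diff_Suc)
qed

lemma sum_atMost_split:
  fixes g :: "nat \<Rightarrow> real"
  assumes "m \<le> q"
  shows "(\<Sum>t\<le>q. g t) = (\<Sum>t<m. g t) + g m + (\<Sum>t\<in>{m<..q}. g t)"
proof -
  have "{..q} = insert m {..<m} \<union> {m<..q}" using assms by auto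
  then have "(\<Sum>t\<le>q. g t) = (\<Sum>t\<in>insert m {..<m}. g t) + (\<Sum>t\<in>{m<..q}. g t)"
    by (simp only:) (intro sum.union_disjoint, auto)
  then show ?thesis by simp
qed

lemma sum_greaterThanAtMost_split:
  fixes g :: "nat \<Rightarrow> real"
  assumes "a \<le> b" "b \<le> c"
  shows "(\<Sum>t\<in>{a<..c}. g t) = (\<Sum>t\<in>{a<..b}. g t) + (\<Sum>t\<in>{b<..c}. g t)"
proof -
  have "{a<..c} = {a<..b} \<union> {b<..c}" using assms by auto
  then show ?thesis by (simp only:) (intro sum.union_disjoint, auto)
qed

text \<open>
  Compared with the extremal profile \<open>s, \<dots>, s, r, 0, \<dots>, 0\<close> (with \<open>r\<close> at position \<open>m\<close>), mass missing up to
  \<open>m\<close> reappears above \<open>m\<close>; the price \<open>\<kappa>\<close> separates what is saved from what is paid.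
\<close>
lemma weighted_sum_ge:
  fixes c \<Phi> :: "nat \<Rightarrow> real"
  assumes "m \<le> q"
    and total: "real s * m + r \<le> (\<Sum>t\<le>q. \<Phi> t)"
    and le: "\<And>t. t < m \<Longrightarrow> \<Phi> t \<le> s"
    and c_le: "\<And>t. t < m \<Longrightarrow> c t \<le> \<kappa>"
    and c_m: "(r - \<Phi> m) * c m \<le> (r - \<Phi> m) * \<kappa>"
    and gain: "\<kappa> * (\<Sum>t\<in>{m<..q}. \<Phi> t) \<le> (\<Sum>t\<in>{m<..q}. c t * \<Phi> t)"
    and "0 \<le> \<kappa>"
  shows "s * (\<Sum>t<m. c t) + r * c m \<le> (\<Sum>t\<le>q. c t * \<Phi> t)"
proof -
  have "(\<Sum>t<m. c t * (s - \<Phi> t)) \<le> (\<Sum>t<m. \<kappa> * (s - \<Phi> t))"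
    using le c_le by (intro sum_mono mult_right_mono) (auto simp: algebra_simps)
  then have 1: "s * (\<Sum>t<m. c t) - (\<Sum>t<m. c t * \<Phi> t) \<le> \<kappa> * (real s * m - (\<Sum>t<m. \<Phi> t))"
    by (simp add: right_diff_distrib sum_subtractf sum_distrib_left mult.commute mult.left_commute)
  have "\<kappa> * (real s * m + r) \<le> \<kappa> * (\<Sum>t\<le>q. \<Phi> t)"
    using total \<open>0 \<le> \<kappa>\<close> by (rule mult_left_mono)
  then have 2: "\<kappa> * (real s * m - (\<Sum>t<m. \<Phi> t)) + (r - \<Phi> m) * \<kappa> \<le> \<kappa> * (\<Sum>t\<in>{m<..q}. \<Phi> t)"
    unfolding sum_atMost_split[OF \<open>m \<le> q\<close>] by (simp add: algebra_simps)
  show ?thesis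
    unfolding sum_atMost_split[OF \<open>m \<le> q\<close>] using 1 2 c_m gain by (simp add: algebra_simps)
qed

text \<open>The first \<open>N\<close> terms of a decreasing sequence have at least the average of
  the whole range; both blocks are compared with the boundary value
  \<open>\<Phi> (m + N)\<close>.\<close>

lemma sum_prefix_ge_average:
  fixes \<Phi> :: "nat \<Rightarrow> real"
  assumes "m + N \<le> q"
    and dec: "\<And>i j. i \<le> j \<Longrightarrow> j \<le> q \<Longrightarrow> \<Phi> j \<le> \<Phi> i"
  shows "real N * (\<Sum>t\<in>{m<..q}. \<Phi> t) \<le> real (q - m) * (\<Sum>t\<in>{m<..m + N}. \<Phi> t)"
proof -
  let ?A = "\<Sum>t\<in>{m<..m + N}. \<Phi> t" and ?B = "\<Sum>t\<in>{m + N<..q}. \<Phi> t"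
  have "(\<Sum>t\<in>{m<..m + N}. \<Phi> (m + N)) \<le> ?A"
    using assms(1) by (intro sum_mono dec) auto
  then have A: "real N * \<Phi> (m + N) \<le> ?A" by simp
  have "?B \<le> (\<Sum>t\<in>{m + N<..q}. \<Phi> (m + N))"
    using assms(1) by (intro sum_mono dec) auto
  then have B: "?B \<le> real (q - (m + N)) * \<Phi> (m + N)" by simp
  have "real N * ?B \<le> real N * (real (q - (m + N)) * \<Phi> (m + N))"
    using B by (intro mult_left_mono) auto
  also have "\<dots> \<le> real (q - (m + N)) * ?A"
    using mult_left_mono[OF A, of "real (q - (m + N))"] by (simp add: algebra_simps)
  finally have "real N * ?B \<le> real (q - (m + N)) * ?A" .
  moreover have "real (q - m) = real N + real (q - (m + N))" using assms(1) by simp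
  ultimately show ?thesis
    using sum_greaterThanAtMost_split[of m "m + N" q \<Phi>] assms(1) by (simp add: algebra_simps)
qed

text \<open>Supplies \<open>gain\<close> of \<open>weighted_sum_ge\<close> for the price
  \<open>n choose (k - 1)\<close>. At least the fraction \<open>k / (q - m)\<close> of the mass lies
  on the first \<open>k\<close> layers above \<open>m\<close>, where the coefficients are at least
  \<open>n choose k\<close>; the ratio \<open>(n - k + 1) / k\<close> of \<open>n choose k\<close>
  to the price compensates, since \<open>q - m \<le> n - k + 1\<close>.\<close>

lemma binomial_weighted_tail_ge:
  fixes \<Phi> :: "nat \<Rightarrow> real"
  assumes "1 \<le> k" "k \<le> m + 1" "m + 2 * k \<le> n" "m + k \<le> q" "q + k \<le> n + m + 1"
    and nonneg: "\<And>t. 0 \<le> \<Phi> t"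
    and dec: "\<And>i j. i \<le> j \<Longrightarrow> j \<le> q \<Longrightarrow> \<Phi> j \<le> \<Phi> i"
  shows "real (n choose (k - 1)) * (\<Sum>t\<in>{m<..q}. \<Phi> t) \<le> (\<Sum>t\<in>{m<..q}. real (n choose t) * \<Phi> t)"
proof -
  let ?S = "\<Sum>t\<in>{m<..q}. \<Phi> t" and ?A = "\<Sum>t\<in>{m<..m + k}. \<Phi> t"
  have A0: "0 \<le> ?A" by (intro sum_nonneg nonneg)
  have "real k * ?S \<le> real (q - m) * ?A"
    using assms(4) dec by (rule sum_prefix_ge_average)
  then have "real k * (real (n choose (k - 1)) * ?S) \<le> real (n choose (k - 1)) * (real (q - m) * ?A)"
    using mult_left_mono[of "real k * ?S" "real (q - m) * ?A" "real (n choose (k - 1))"]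
    by (simp only: mult.left_commute)
  also have "\<dots> \<le> real (n choose (k - 1)) * (real (n - k + 1) * ?A)"
    using assms A0 by (intro mult_left_mono mult_right_mono) auto
  also have "\<dots> = real k * (real (n choose k) * ?A)"
    using binomial_step[of k n] assms(1,3) by (simp only: mult.assoc[symmetric]) (simp add: mult.commute)
  finally have "real (n choose (k - 1)) * ?S \<le> real (n choose k) * ?A"
    by (rule mult_left_le_imp_le) (use assms in simp)
  also have "\<dots> = (\<Sum>t\<in>{m<..m + k}. real (n choose k) * \<Phi> t)"
    by (rule sum_distrib_left)
  also have "\<dots> \<le> (\<Sum>t\<in>{m<..m + k}. real (n choose t) * \<Phi> t)"
    using assms(2,3) by (intro sum_mono mult_right_mono nonneg) (auto intro!: binomial_le_middle)
  also have "\<dots> \<le> (\<Sum>t\<in>{m<..q}. real (n choose t) * \<Phi> t)"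
    using assms(4) nonneg by (intro sum_mono2) auto
  finally show ?thesis .
qed

text \<open>
  For \<open>s = 3\<close>, \<open>l = 2\<close>, \<open>n = q\<close> the previous tail estimate just fails, and one has to know in addition that
  \<open>\<Phi> n\<close> is an integer (the number of empty families).
\<close>
lemma binomial_weighted_sum_ge_critical:
  fixes \<Phi> :: "nat \<Rightarrow> real"
  assumes n: "n = 3 * m + 1" and "1 \<le> m"
    and nonneg: "\<And>t. 0 \<le> \<Phi> t"
    and dec: "\<And>i j. i \<le> j \<Longrightarrow> j \<le> n \<Longrightarrow> \<Phi> j \<le> \<Phi> i"
    and le: "\<And>t. \<Phi> t \<le> 3"
    and total: "real n + 1 \<le> (\<Sum>t\<le>n. \<Phi> t)"
    and last: "\<Phi> n = 0 \<or> 1 \<le> \<Phi> n"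
  shows "3 * (\<Sum>t<m. real (n choose t)) + 2 * real (n choose m) \<le> (\<Sum>t\<le>n. real (n choose t) * \<Phi> t)"
  using last
proof
  assume 0: "\<Phi> n = 0"
  \<comment> \<open>The range above \<open>m\<close> is cut at \<open>2 * m + 1\<close>, whose
    coefficient equals \<open>n choose m\<close> by symmetry. The layers beyond have smaller
    coefficients; their weighted sum is bounded by 0, and the surplus of \<open>S\<close> pays for
    them.\<close>
  define S where "S = (\<Sum>t\<in>{m<..2 * m}. \<Phi> t)"
  define p where "p = \<Phi> (2 * m + 1)"
  define R where "R = (\<Sum>t\<in>{2 * m + 1<..n}. \<Phi> t)"
  have split: "(\<Sum>t\<in>{m<..n}. g t) =
      (\<Sum>t\<in>{m<..2 * m}. g t) + g (2 * m + 1) + (\<Sum>t\<in>{2 * m + 1<..n}. g t)" for g :: "nat \<Rightarrow> real"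
  proof -
    have "{2 * m<..2 * m + 1} = {2 * m + 1}" by auto
    then show ?thesis
      using sum_greaterThanAtMost_split[of m "2 * m" n g]
        sum_greaterThanAtMost_split[of "2 * m" "2 * m + 1" n g] n by simp
  qed
  have p0: "0 \<le> p" unfolding p_def by (rule nonneg)
  have "(\<Sum>t\<in>{m<..2 * m}. p) \<le> S"
    unfolding S_def p_def using n by (intro sum_mono dec) auto
  then have S: "real m * p \<le> S" by simp
  \<comment> \<open>\<open>\<Phi> n = 0\<close> leaves only \<open>m - 1\<close> terms in
    \<open>R\<close>, so that \<open>(m + 1) * (m - 1) \<le> m * m\<close> is enough below.\<close>
  have "R = (\<Sum>t\<in>{2 * m + 1<..3 * m}. \<Phi> t)"
    unfolding R_def using 0 n by (intro sum.mono_neutral_right) (auto simp: not_le le_Suc_eq)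
  also have "\<dots> \<le> (\<Sum>t\<in>{2 * m + 1<..3 * m}. p)"
    unfolding p_def using n by (intro sum_mono dec) auto
  finally have R: "R \<le> (real m - 1) * p" using \<open>1 \<le> m\<close> by (simp add: of_nat_diff)
  have "(real m + 1) * R \<le> (real m + 1) * ((real m - 1) * p)"
    using R by (intro mult_left_mono) auto
  also have "\<dots> \<le> real m * (real m * p)" using p0 by (simp add: algebra_simps)
  also have "\<dots> \<le> real m * S" using S by (intro mult_left_mono) auto
  finally have RS: "(real m + 1) * R \<le> real m * S" .
  \<comment> \<open>This ratio of coefficients leaves \<open>m / (m + 1)\<close> of
    \<open>(n choose m) * S\<close> as surplus, which covers
    \<open>(n choose m) * R\<close>.\<close>
  have step: "(real m + 1) * (n choose (m + 1)) = (2 * real m + 1) * (n choose m)"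
    using binomial_step[of "m + 1" n] n by (simp add: algebra_simps)
  have "(real m + 1) * (real (n choose m) * (S + R)) \<le> (2 * real m + 1) * (n choose m) * S"
    using mult_left_mono[OF RS, of "real (n choose m)"] by (simp add: algebra_simps)
  also have "\<dots> = (real m + 1) * (real (n choose (m + 1)) * S)"
    using step by (metis mult.assoc)
  finally have "real (n choose m) * (S + R) \<le> real (n choose (m + 1)) * S"
    by (rule mult_left_le_imp_le) simp
  also have "\<dots> = (\<Sum>t\<in>{m<..2 * m}. real (n choose (m + 1)) * \<Phi> t)"
    unfolding S_def by (rule sum_distrib_left)
  also have "\<dots> \<le> (\<Sum>t\<in>{m<..2 * m}. real (n choose t) * \<Phi> t)"
    using n by (intro sum_mono mult_right_mono nonneg of_nat_mono binomial_le_middle) auto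
  finally have 1: "real (n choose m) * (S + R) \<le> (\<Sum>t\<in>{m<..2 * m}. real (n choose t) * \<Phi> t)" .
  have 2: "real (n choose m) * p \<le> real (n choose (2 * m + 1)) * p"
    using n p0 by (intro mult_right_mono of_nat_mono binomial_le_middle) auto
  have 3: "0 \<le> (\<Sum>t\<in>{2 * m + 1<..n}. real (n choose t) * \<Phi> t)"
    by (intro sum_nonneg mult_nonneg_nonneg nonneg) auto
  have "real (3::nat) * (\<Sum>t<m. real (n choose t)) + 2 * real (n choose m) \<le>
      (\<Sum>t\<le>n. real (n choose t) * \<Phi> t)"
  proof (rule weighted_sum_ge[where \<kappa> = "real (n choose m)"])
    show "real (n choose m) * (\<Sum>t\<in>{m<..n}. \<Phi> t) \<le> (\<Sum>t\<in>{m<..n}. real (n choose t) * \<Phi> t)"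
      unfolding split S_def[symmetric] p_def[symmetric] R_def[symmetric]
      using 1 2 3 by (simp add: algebra_simps)
    show "real 3 * real m + 2 \<le> sum \<Phi> {..n}" using total n by simp
    show "real (n choose t) \<le> real (n choose m)" if "t < m" for t
      using that n by (intro of_nat_mono binomial_mono) auto
  qed (use n le in auto)
  then show ?thesis by simp
next
  assume 1: "1 \<le> \<Phi> n"
  \<comment> \<open>Here \<open>\<Phi> \<ge> 1\<close> on all layers, so it is enough that the
    binomials above \<open>m\<close> sum to at least \<open>n choose m\<close> plus twice those
    below \<open>m\<close>.\<close>
  have *: "(\<Sum>t\<le>n. real (n choose t)) \<le> (\<Sum>t\<le>n. real (n choose t) * \<Phi> t)"
  proof (rule sum_mono)
    fix t assume "t \<in> {..n}"
    then have "1 \<le> \<Phi> t" using dec[of t n] 1 by simp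
    then show "real (n choose t) \<le> real (n choose t) * \<Phi> t"
      using mult_left_mono[of 1 "\<Phi> t" "real (n choose t)"] by simp
  qed
  have "(\<Sum>t<m. real (n choose t)) \<le> (\<Sum>t<m. real (n choose (m - 1)))"
    using n by (intro sum_mono of_nat_mono binomial_mono) auto
  then have M: "(\<Sum>t<m. real (n choose t)) \<le> real m * (n choose (m - 1))" by simp
  have "real m * (n choose m) = (2 * real m + 2) * (n choose (m - 1))"
    using binomial_step[of m n] n \<open>1 \<le> m\<close> by (simp add: algebra_simps)
  then have M2: "2 * (\<Sum>t<m. real (n choose t)) \<le> real m * (n choose m)"
    using M by (simp add: algebra_simps)
  \<comment> \<open>Of these \<open>m + 1\<close> layers, \<open>m\<close> cover the doubled lower
    sum by \<open>M2\<close> and one covers \<open>n choose m\<close>.\<close>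
  have "(\<Sum>t\<in>{m<..2 * m + 1}. real (n choose m)) \<le> (\<Sum>t\<in>{m<..2 * m + 1}. real (n choose t))"
    using n by (intro sum_mono of_nat_mono binomial_le_middle) auto
  also have "\<dots> \<le> (\<Sum>t\<in>{m<..n}. real (n choose t))"
    using n by (intro sum_mono2) auto
  finally have "(real m + 1) * (n choose m) \<le> (\<Sum>t\<in>{m<..n}. real (n choose t))"
    by (simp add: add.commute)
  then show ?thesis
    using * M2 sum_atMost_split[of m n "\<lambda>t. real (n choose t)"] n by (simp add: algebra_simps)
qed

lemma binomial_weighted_sum_ge:
  fixes \<Phi> :: "nat \<Rightarrow> real"
  assumes s: "3 \<le> s" and l: "l \<in> {1..s}" and q: "q = s * m + s - l" and "q \<le> n"
    and nonneg: "\<And>t. 0 \<le> \<Phi> t"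
    and dec: "\<And>i j. i \<le> j \<Longrightarrow> j \<le> q \<Longrightarrow> \<Phi> j \<le> \<Phi> i"
    and le: "\<And>t. \<Phi> t \<le> s"
    and total: "real q + 1 \<le> (\<Sum>t\<le>q. \<Phi> t)"
    and balanced: "l = s \<Longrightarrow> 1 \<le> \<Phi> m"
    and last: "n = q \<Longrightarrow> \<Phi> n = 0 \<or> 1 \<le> \<Phi> n"
  shows "s * (\<Sum>t<m. real (n choose t)) + real (s - l + 1) * (n choose m)
    \<le> (\<Sum>t\<le>q. real (n choose t) * \<Phi> t)"
proof -
  have q': "q = s * m + (s - l)" using q l by auto
  have sm: "3 * m \<le> s * m" using s by simp
  have mq: "m \<le> q" using q' sm by linarith
  \<comment> \<open>\<open>q + 1 = s * m + (s - l + 1)\<close> is the total of the extremal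
    profile.\<close>
  have total': "real s * m + real (s - l + 1) \<le> (\<Sum>t\<le>q. \<Phi> t)"
    using total unfolding q' by simp
  have mono: "real (n choose t) \<le> real (n choose k)" if "t \<le> k" "2 * k \<le> n" for t k
    using that by (intro of_nat_mono binomial_mono) auto
  note main = weighted_sum_ge[OF mq total' le]
  \<comment> \<open>The price is \<open>n choose m\<close> where the tail estimate with
    \<open>k = m + 1\<close> applies, which needs \<open>3 * m + 2 \<le> n\<close>. For
    \<open>l = s\<close> the ground set may have only \<open>3 * m\<close> points, so the lower
    price \<open>n choose (m - 1)\<close> is taken.\<close>
  consider (zero) "m = 0" | (full) "m \<ge> 1" "l = s" | (wide) "m \<ge> 1" "l < s" "3 * m + 2 \<le> n"
    | (critical) "m \<ge> 1" "l < s" "n < 3 * m + 2" using l by force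
  then show ?thesis
  proof cases
    case zero
    show ?thesis
    proof (rule main[where \<kappa> = 1])
      have "real 1 * \<Phi> t \<le> real (n choose t) * \<Phi> t" if "t \<le> q" for t
        using that \<open>q \<le> n\<close> by (intro mult_right_mono nonneg of_nat_mono)
          (simp add: Suc_le_eq zero_less_binomial_iff)
      then show "1 * (\<Sum>t\<in>{m<..q}. \<Phi> t) \<le> (\<Sum>t\<in>{m<..q}. real (n choose t) * \<Phi> t)"
        by (auto intro!: sum_mono)
    qed (use zero in auto)
  next
    case full
    have n3: "3 * m \<le> q" "q = s * m" using q' full sm by auto
    show ?thesis
    proof (rule main[where \<kappa> = "real (n choose (m - 1))"])
      show "real (n choose t) \<le> real (n choose (m - 1))" if "t < m" for t
        using that n3(1) \<open>q \<le> n\<close> by (intro mono) linarith+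
      \<comment> \<open>For \<open>l = s\<close> the extremal value at \<open>m\<close> is 1, and
        \<open>\<Phi> m \<ge> 1\<close> makes the factor below nonpositive, so the price may lie
        under \<open>n choose m\<close>.\<close>
      have "real (n choose (m - 1)) \<le> real (n choose m)"
        using n3(1) \<open>q \<le> n\<close> by (intro mono) linarith+
      then show "(real (s - l + 1) - \<Phi> m) * real (n choose m)
          \<le> (real (s - l + 1) - \<Phi> m) * real (n choose (m - 1))"
        using balanced full by (intro mult_left_mono_neg) auto
      show "real (n choose (m - 1)) * (\<Sum>t\<in>{m<..q}. \<Phi> t)
          \<le> (\<Sum>t\<in>{m<..q}. real (n choose t) * \<Phi> t)"
        using full(1) n3(1) \<open>q \<le> n\<close> by (intro binomial_weighted_tail_ge nonneg dec) linarith+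
    qed auto
  next
    case wide
    have q3: "3 * m + 1 \<le> q" using wide q' sm by linarith
    show ?thesis
    proof (rule main[where \<kappa> = "real (n choose m)"])
      show "real (n choose t) \<le> real (n choose m)" if "t < m" for t
        using that wide by (intro mono) auto
      have "real (n choose (m + 1 - 1)) * (\<Sum>t\<in>{m<..q}. \<Phi> t)
          \<le> (\<Sum>t\<in>{m<..q}. real (n choose t) * \<Phi> t)"
        using wide(1,3) q3 \<open>q \<le> n\<close> by (intro binomial_weighted_tail_ge nonneg dec) auto
      then show "real (n choose m) * (\<Sum>t\<in>{m<..q}. \<Phi> t)
          \<le> (\<Sum>t\<in>{m<..q}. real (n choose t) * \<Phi> t)" by simp
    qed auto
  next
    case critical
    \<comment> \<open>As \<open>l < s\<close> gives \<open>q \<ge> s * m + 1\<close>, the bound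
      \<open>n < 3 * m + 2\<close> leaves only \<open>s = 3\<close>, \<open>l = 2\<close>,
      \<open>n = q\<close>.\<close>
    have "\<not> 4 \<le> s"
    proof
      assume "4 \<le> s"
      then have "4 * m \<le> s * m" by simp
      then show False using critical q' \<open>q \<le> n\<close> by linarith
    qed
    then have s3: "s = 3" using s by simp
    then have l2: "l = 2" and n: "n = q" "n = 3 * m + 1"
      using critical q' \<open>q \<le> n\<close> by auto
    show ?thesis
      using binomial_weighted_sum_ge_critical[of n m \<Phi>] n critical(1) nonneg dec le total last s3 l2
      by simp
  qed
qed

text \<open>Layers \<open>t\<close> and \<open>q - t\<close> are paired: for
  \<open>2 * t \<le> q \<le> n\<close> the coefficient at \<open>q - t\<close> is at least that at
  \<open>t\<close>, so each pair contributes at least \<open>2 * (n choose t)\<close>.\<close>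

lemma binomial_weighted_sum_ge_two:
  fixes \<Phi> :: "nat \<Rightarrow> real"
  assumes l: "l \<in> {1..2}" and q: "q = 2 * m + 2 - l" and "q \<le> n"
    and nonneg: "\<And>t. 0 \<le> \<Phi> t"
    and pairs: "\<And>t. t \<le> q \<Longrightarrow> 2 \<le> \<Phi> t + \<Phi> (q - t)"
  shows "2 * (\<Sum>t<m. real (n choose t)) + real (2 - l + 1) * (n choose m)
    \<le> (\<Sum>t\<le>q. real (n choose t) * \<Phi> t)"
proof -
  let ?g = "\<lambda>t. real (n choose t) * \<Phi> t"
  have pair: "2 * real (n choose t) \<le> ?g t + ?g (q - t)" if "2 * t \<le> q" for t
  proof -
    have "real (n choose t) * 2 \<le> real (n choose t) * (\<Phi> t + \<Phi> (q - t))"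
      using pairs[of t] that by (intro mult_left_mono) auto
    moreover have "real (n choose t) * \<Phi> (q - t) \<le> ?g (q - t)"
      using that \<open>q \<le> n\<close> by (intro mult_right_mono nonneg of_nat_mono binomial_le_middle) auto
    ultimately show ?thesis by (simp add: algebra_simps)
  qed
  have refl: "(\<Sum>t\<in>{m<..q}. ?g t) = (\<Sum>t<q - m. ?g (q - t))"
    by (rule sum.reindex_bij_witness[of _ "\<lambda>t. q - t" "\<lambda>t. q - t"]) auto
  have sum_pair: "2 * (\<Sum>t<p. real (n choose t)) \<le> (\<Sum>t<p. ?g t) + (\<Sum>t<p. ?g (q - t))"
    if "\<And>t. t < p \<Longrightarrow> 2 * t \<le> q" for p
  proof -
    have "(\<Sum>t<p. 2 * real (n choose t)) \<le> (\<Sum>t<p. ?g t + ?g (q - t))"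
      using that by (intro sum_mono pair) auto
    then show ?thesis by (simp add: sum_distrib_left sum.distrib)
  qed
  have split: "(\<Sum>t\<le>q. ?g t) = (\<Sum>t<m. ?g t) + ?g m + (\<Sum>t<q - m. ?g (q - t))"
    using sum_atMost_split[of m q ?g] refl q l by auto
  consider "l = 1" "q = 2 * m + 1" | "l = 2" "q = 2 * m" using q l by force
  then show ?thesis
  proof cases
    case 1
    then have "q - m = Suc m" by simp
    then show ?thesis
      using split sum_pair[of "Suc m"] 1 by (simp add: algebra_simps)
  next
    \<comment> \<open>For \<open>q = 2 * m\<close> the layer \<open>m\<close> is its own partner and
      yields \<open>n choose m\<close> only once.\<close>
    case 2
    then have "q - m = m" by simp
    then show ?thesis
      using split sum_pair[of m] pair[of m] 2 by (simp add: algebra_simps)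
  qed
qed

section \<open>Up-closed enlargement of the families and the final count\<close>

theorem theorem2:
  fixes s m l q n :: nat and F :: "nat \<Rightarrow> nat set set"
  assumes "s \<ge> 2"
    and "l \<in> {1..s}"
    and "q = s * m + s - l"
    and "n \<ge> q"
    and "\<And>i. i \<in> {1..s} \<Longrightarrow> F i \<subseteq> Pow {1..n}"
    and "q_dependent q s F"
  shows "(\<Sum>i=1..s. card (F i)) \<le> (l - 1) * (n choose m) + s * (\<Sum>t=m+1..n. n choose t)"
proof -
  define V where "V = {1..n}"
  define I where "I = {1..s}"
  \<comment> \<open>Sets of more than \<open>q\<close> elements may be added at will, as no choice
    with a union of size at most \<open>q\<close> uses one.\<close>
  define U where "U = (\<lambda>i. {X. X \<subseteq> V \<and> (q < card X \<or> (\<exists>Y\<in>F i. Y \<subseteq> X))})"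
  define \<Phi> where "\<Phi> = (\<lambda>t. \<Sum>i\<in>I. miss_density V (U i) t)"
  have V: "finite V" "card V = n" and I: "finite I" "card I = s"
    by (auto simp: V_def I_def)
  have U: "U i \<subseteq> Pow V" for i by (auto simp: U_def)
  have mq: "m \<le> q" using assms(1-3) by (cases s) auto
  have dep: "cross_dependent q I V U"
    unfolding cross_dependent_def
  proof (rule notI, elim exE conjE)
    fix G assume G: "\<forall>i\<in>I. G i \<in> U i \<and> G i \<subseteq> V"
      and disj: "disjoint_family_on G I" and le: "card (\<Union>i\<in>I. G i) \<le> q"
    have fin: "finite (\<Union>i\<in>I. G i)"
      using G by (intro finite_subset[OF _ V(1)]) auto
    \<comment> \<open>Each chosen set has at most \<open>q\<close> elements, hence contains a member
      of \<open>F i\<close>; shrinking to these members keeps disjointness and the size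
      bound.\<close>
    have "\<exists>Y\<in>F i. Y \<subseteq> G i" if i: "i \<in> I" for i
    proof -
      have "card (G i) \<le> q" using le card_mono[OF fin, of "G i"] i by force
      then show ?thesis using G i by (auto simp: U_def)
    qed
    then obtain H where H: "\<And>i. i \<in> I \<Longrightarrow> H i \<in> F i" "\<And>i. i \<in> I \<Longrightarrow> H i \<subseteq> G i" by metis
    have "disjoint_family_on H I"
      using disj H(2) unfolding disjoint_family_on_def by blast
    moreover have "card (\<Union>i\<in>I. H i) \<le> q"
      using le card_mono[OF fin, of "\<Union>i\<in>I. H i"] H(2) by fastforce
    ultimately show False
      using assms(6) H(1) unfolding q_dependent_def I_def by blast
  qed
  have up: "insert x X \<in> U i" if "X \<in> U i" "X \<subseteq> V" "x \<in> V" for i x X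
  proof -
    have "card X \<le> card (insert x X)"
      using finite_subset[OF that(2) V(1)] by (intro card_mono) auto
    then show ?thesis using that by (auto simp: U_def)
  qed
  have nonneg: "0 \<le> \<Phi> t" for t
    unfolding \<Phi>_def by (intro sum_nonneg miss_density_nonneg)
  have le: "\<Phi> t \<le> s" for t
    unfolding \<Phi>_def using sum_mono[of I "\<lambda>i. miss_density V (U i) t" "\<lambda>_. 1"]
      miss_density_le_1[OF V(1)] I by simp
  have beyond: "\<Phi> t = 0" if "q < t" for t
  proof -
    have "missing V (U i) t = {}" for i using that by (auto simp: missing_def U_def)
    then show ?thesis by (simp add: \<Phi>_def miss_density_def)
  qed
  have dec: "\<Phi> j \<le> \<Phi> i" if "i \<le> j" "j \<le> q" for i j
    using that
  proof (induction rule: dec_induct)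
    case (step t)
    have "\<Phi> (Suc t) \<le> \<Phi> t"
      unfolding \<Phi>_def using V step assms(4)
      by (intro sum_mono miss_density_Suc_le up) auto
    then show ?case using step by simp
  qed simp
  have all: "(\<Sum>t\<le>n. g t * \<Phi> t) = (\<Sum>t\<le>q. g t * \<Phi> t)" for g
    using assms(4) beyond by (intro sum.mono_neutral_right) auto
  have total: "real q + 1 \<le> (\<Sum>t\<le>q. \<Phi> t)"
  proof -
    have "real q + 1 \<le> (\<Sum>i\<in>I. \<Sum>t\<le>n. miss_density V (U i) t)"
      using sum_miss_density_ge[OF V(1) I(1) _ dep] V assms(4) by simp
    also have "\<dots> = (\<Sum>t\<le>n. \<Phi> t)" unfolding \<Phi>_def by (rule sum.swap)
    finally show ?thesis using all[of "\<lambda>_. 1"] by simp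
  qed
  have sizes: "1 \<le> (\<Sum>i\<in>I. miss_density V (U i) (a i))" if "sum a I = q" for a
    using sum_miss_density_sizes_ge_1[of V I a U] V I dep that assms(4) by simp
  \<comment> \<open>For \<open>l = s\<close> one has \<open>q = s * m\<close>, so every size may be
    \<open>m\<close>.\<close>
  have balanced: "1 \<le> \<Phi> m" if "l = s"
    using sizes[of "\<lambda>_. m"] I assms(3) that by (simp add: \<Phi>_def)
  \<comment> \<open>\<open>V\<close> is the only subset of size \<open>n\<close>, so
    \<open>\<Phi> n\<close> counts the \<open>U i\<close> that do not contain
    \<open>V\<close>.\<close>
  have last: "\<Phi> n = 0 \<or> 1 \<le> \<Phi> n"
  proof (cases "\<forall>i\<in>I. V \<in> U i")
    case True
    then show ?thesis using miss_density_top[OF V(1)] V(2) by (simp add: \<Phi>_def)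
  next
    case False
    then obtain i where i: "i \<in> I" "V \<notin> U i" by blast
    then have "1 = miss_density V (U i) n" using miss_density_top[OF V(1), of "U i"] V(2) by simp
    also have "\<dots> \<le> \<Phi> n"
      unfolding \<Phi>_def using i I by (intro member_le_sum) (auto simp: miss_density_nonneg)
    finally show ?thesis by simp
  qed
  have bound: "s * (\<Sum>t<m. real (n choose t)) + real (s - l + 1) * (n choose m)
      \<le> (\<Sum>t\<le>q. real (n choose t) * \<Phi> t)"
  proof (cases "s = 2")
    case True
    have I2: "I = {1, 2}" using True by (auto simp: I_def)
    \<comment> \<open>The sizes \<open>(t, q - t)\<close> and \<open>(q - t, t)\<close> are both
      admissible; adding the two inequalities gives the pair bound.\<close>
    have "2 \<le> \<Phi> t + \<Phi> (q - t)" if t: "t \<le> q" for t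
      using sizes[of "\<lambda>i. if i = 1 then t else q - t"] sizes[of "\<lambda>i. if i = 1 then q - t else t"] t
      by (simp add: I2 \<Phi>_def)
    then show ?thesis
      using binomial_weighted_sum_ge_two[of l q m n \<Phi>] True assms(2-4) nonneg by simp
  next
    case False
    then show ?thesis
      using assms(1-4) by (intro binomial_weighted_sum_ge nonneg dec le total balanced last) auto
  qed
  have "real (\<Sum>i\<in>I. card (F i)) \<le> (\<Sum>i\<in>I. real (card (U i)))"
  proof -
    have "card (F i) \<le> card (U i)" if "i \<in> I" for i
      using assms(5)[of i] that finite_subset[OF U finite_Pow_iff[THEN iffD2, OF V(1)]]
      by (intro card_mono) (auto simp: U_def V_def I_def)
    then show ?thesis by (simp add: sum_mono)
  qed
  also have "\<dots> = (\<Sum>i\<in>I. \<Sum>t\<le>n. real (n choose t) * (1 - miss_density V (U i) t))"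
    using card_family_eq[OF V(1) U] V(2) by simp
  also have "\<dots> = (\<Sum>t\<le>n. \<Sum>i\<in>I. real (n choose t) * (1 - miss_density V (U i) t))"
    by (rule sum.swap)
  also have "\<dots> = (\<Sum>t\<le>n. real (n choose t) * (s - \<Phi> t))"
    using I by (simp add: \<Phi>_def sum_subtractf flip: sum_distrib_left)
  also have "\<dots> = s * (\<Sum>t\<le>n. real (n choose t)) - (\<Sum>t\<le>q. real (n choose t) * \<Phi> t)"
    by (simp only: right_diff_distrib sum_subtractf all) (simp add: sum_distrib_left mult.commute)
  also have "\<dots> \<le> s * (\<Sum>t\<le>n. real (n choose t))
      - (s * (\<Sum>t<m. real (n choose t)) + real (s - l + 1) * (n choose m))"
    using bound by simp
  \<comment> \<open>The layers below \<open>m\<close> cancel, and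
    \<open>s - (s - l + 1) = l - 1\<close> remains at layer \<open>m\<close>.\<close>
  also have "\<dots> = real (l - 1) * (n choose m) + s * (\<Sum>t\<in>{m<..n}. real (n choose t))"
    using sum_atMost_split[of m n "\<lambda>t. real (n choose t)"] mq assms(2,4)
    by (simp add: of_nat_diff algebra_simps)
  also have "\<dots> = real ((l - 1) * (n choose m) + s * (\<Sum>t=m+1..n. n choose t))"
    by (simp add: atLeastSucAtMost_greaterThanAtMost)
  finally show ?thesis unfolding I_def using of_nat_le_iff by blast
qed

end
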